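(* Let $L$ be a complete multiplicative lattice. Then $\mathrm{Spec}(L)$ is a spectral space whenever the following conditions hold: (a) $L$ is compact, algebraic, and distributive; (b) $L$ satisfies the weak Kaplansky condition; (c) if $x$ and $y$ are compact elements in $L$, then there exists a compact $c\in L$ with $\sqrt{c}=\sqrt{xy}$.
   Context: A complete multiplicative lattice is a complete lattice $L$ (smallest element $0$, largest element $1$) equipped with a binary multiplication satisfying $xy\leqslant x\wedge y$ for all $x,y\in L$; nothing else is assumed about the multiplication in general. $L$ is distributive if $x(y\vee z)=xy\vee xz$ and $(x\vee y)z=xz\vee yz$ for all $x,y,z\in L$. An element $p\neq 1$ of $L$ is prime if for all $x,y\in L$, $xy\leqslant p$ implies $x\leqslant p$ or $y\leqslant p$. $\mathrm{Spec}(L)$ is the set of all prime elements of $L$, with the Zariski topology, whose closed sets are exactly the sets $\mathrm{V}(x)=\{p\in\mathrm{Spec}(L)\mid x\leqslant p\}$, $x\in L$. An element of $L$ is radical if it is a meet of a (possibly empty) set of prime elements; $\sqrt{x}$ is the smallest radical element $r$ with $x\leqslant r$. An element $x$ of a complete lattice is compact if every subset $S$ with $x\leqslant\bigvee S$ has a finite subset $F$ with $x\leqslant\bigvee F$; the lattice is compact if its largest element is compact; it is algebraic if every element is a join of compact elements. Weak Kaplansky condition: whenever $x\in L$ is compact, so is $x^2=xx$. A spectral space is a compact sober topological space in which the compact open subsets form a basis of the topology that is closed under finite intersections; sober means $\mathrm{T}_0$ and every irreducible closed subset is the closure of a one-element set. *)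

theory Defs
  imports "HOL-Analysis.Abstract_Topological_Spaces"
begin

text \<open>The least and largest elements are \<^term>\<open>bot\<close> and \<^term>\<open>top\<close> (possibly equal). No
  associativity, commutativity, unit or monotonicity of the multiplication is assumed.\<close>

class complete_multiplicative_lattice = complete_lattice + times +
  assumes mult_le_inf: "x * y \<le> inf x y"

definition compact_element :: "'a::complete_lattice \<Rightarrow> bool" where
  "compact_element x \<longleftrightarrow> (\<forall>S. x \<le> Sup S \<longrightarrow> (\<exists>F. F \<subseteq> S \<and> finite F \<and> x \<le> Sup F))"

definition prime_element :: "'a::complete_multiplicative_lattice \<Rightarrow> bool" where
  "prime_element p \<longleftrightarrow> p \<noteq> top \<and> (\<forall>x y. x * y \<le> p \<longrightarrow> x \<le> p \<or> y \<le> p)"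

definition Spec :: "'a::complete_multiplicative_lattice set" where
  "Spec = {p. prime_element p}"

definition V_set :: "'a::complete_multiplicative_lattice \<Rightarrow> 'a set" where
  "V_set x = {p \<in> Spec. x \<le> p}"

definition zariski_topology :: "'a::complete_multiplicative_lattice topology" where
  "zariski_topology = topology (\<lambda>U. \<exists>x. U = Spec - V_set x)"

definition radical_element :: "'a::complete_multiplicative_lattice \<Rightarrow> bool" where
  "radical_element r \<longleftrightarrow> (\<exists>P. P \<subseteq> Spec \<and> r = Inf P)"

definition radical :: "'a::complete_multiplicative_lattice \<Rightarrow> 'a" where
  "radical x = (LEAST r. radical_element r \<and> x \<le> r)"

definition irreducible_in :: "'a topology \<Rightarrow> 'a set \<Rightarrow> bool" where
  "irreducible_in X C \<longleftrightarrow> C \<subseteq> topspace X \<and> C \<noteq> {} \<and>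
     (\<forall>A B. closedin X A \<and> closedin X B \<and> C \<subseteq> A \<union> B \<longrightarrow> C \<subseteq> A \<or> C \<subseteq> B)"

definition sober_space :: "'a topology \<Rightarrow> bool" where
  "sober_space X \<longleftrightarrow> t0_space X \<and>
     (\<forall>C. closedin X C \<and> irreducible_in X C \<longrightarrow> (\<exists>p\<in>topspace X. C = X closure_of {p}))"

text \<open>Intersecting with \<^term>\<open>topspace X\<close> makes the empty intersection the whole space.\<close>

definition spectral_space :: "'a topology \<Rightarrow> bool" where
  "spectral_space X \<longleftrightarrow> compact_space X \<and> sober_space X \<and>
     (\<forall>U. openin X U \<longrightarrow> (\<exists>\<B>. (\<forall>B\<in>\<B>. openin X B \<and> compactin X B) \<and> U = \<Union>\<B>)) \<and>
     (\<forall>\<F>. finite \<F> \<and> (\<forall>B\<in>\<F>. openin X B \<and> compactin X B) \<longrightarrow>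
        openin X (topspace X \<inter> \<Inter>\<F>) \<and> compactin X (topspace X \<inter> \<Inter>\<F>))"

text \<open>The definitions by \<^const>\<open>topology\<close> and \<^const>\<open>Least\<close> are meaningful: the complements of the
  sets \<^term>\<open>V_set x\<close> do form a topology on \<^const>\<open>Spec\<close>, and the least radical element exists.\<close>

lemma V_set_mult: "V_set (x * y) = V_set x \<union> V_set y"
proof -
  have "x * y \<le> x" "x * y \<le> y"
    using mult_le_inf[of x y] by auto
  then show ?thesis
    unfolding V_set_def Spec_def prime_element_def by (auto intro: order_trans)
qed

lemma V_set_Sup: "V_set (Sup S) = Spec \<inter> (\<Inter>x\<in>S. V_set x)"
  unfolding V_set_def by (auto simp: Sup_le_iff)

lemma V_set_top: "V_set top = {}"
  unfolding V_set_def Spec_def prime_element_def by (auto simp: top_unique)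

lemma openin_zariski: "openin zariski_topology U \<longleftrightarrow> (\<exists>x. U = Spec - V_set x)"
proof -
  have "istopology (\<lambda>U. \<exists>x::'a. U = Spec - V_set x)"
    unfolding istopology_def
  proof (intro conjI allI impI)
    fix S T :: "'a set"
    assume "\<exists>x. S = Spec - V_set x" "\<exists>x. T = Spec - V_set x"
    then obtain x y where "S = Spec - V_set x" "T = Spec - V_set y" by blast
    then have "S \<inter> T = Spec - V_set (x * y)" by (auto simp: V_set_mult)
    then show "\<exists>x. S \<inter> T = Spec - V_set x" by blast
  next
    fix \<K> :: "'a set set"
    assume "\<forall>K\<in>\<K>. \<exists>x. K = Spec - V_set x"
    then obtain f where "\<And>K. K \<in> \<K> \<Longrightarrow> K = Spec - V_set (f K)" by metis
    then have "\<Union>\<K> = Spec - V_set (Sup (f ` \<K>))" by (auto simp: V_set_Sup)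
    then show "\<exists>x. \<Union>\<K> = Spec - V_set x" by blast
  qed
  then show ?thesis by (simp add: zariski_topology_def)
qed

lemma topspace_zariski:
  "topspace (zariski_topology :: 'a::complete_multiplicative_lattice topology) = Spec"
proof -
  have "openin zariski_topology (Spec :: 'a set)"
    unfolding openin_zariski by (rule exI[of _ top]) (simp add: V_set_top)
  then have "Spec \<subseteq> topspace (zariski_topology :: 'a topology)"
    by (rule openin_subset)
  moreover have "topspace (zariski_topology :: 'a topology) \<subseteq> Spec"
    unfolding topspace_def openin_zariski by blast
  ultimately show ?thesis by blast
qed

lemma closedin_zariski: "closedin zariski_topology C \<longleftrightarrow> (\<exists>x. C = V_set x)"
proof
  assume "closedin zariski_topology C"
  then obtain x where "C \<subseteq> Spec" "Spec - C = Spec - V_set x"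
    unfolding closedin_def topspace_zariski openin_zariski by blast
  moreover have "V_set x \<subseteq> Spec" by (auto simp: V_set_def)
  ultimately have "C = V_set x" by blast
  then show "\<exists>x. C = V_set x" ..
next
  assume "\<exists>x. C = V_set x"
  then show "closedin zariski_topology C"
    unfolding closedin_def topspace_zariski openin_zariski by (auto simp: V_set_def)
qed

lemma radical_eq_Inf: "radical x = Inf (V_set x)"
  unfolding radical_def
proof (rule Least_equality)
  show "radical_element (Inf (V_set x)) \<and> x \<le> Inf (V_set x)"
  proof
    show "radical_element (Inf (V_set x))"
      unfolding radical_element_def by (rule exI[of _ "V_set x"]) (auto simp: V_set_def)
    show "x \<le> Inf (V_set x)"
      by (rule Inf_greatest) (simp add: V_set_def)
  qed
  show "Inf (V_set x) \<le> r" if r: "radical_element r \<and> x \<le> r" for r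
  proof -
    obtain P where "P \<subseteq> Spec" "r = Inf P" "x \<le> r"
      using r unfolding radical_element_def by blast
    then have "P \<subseteq> V_set x"
      unfolding V_set_def by (blast intro: order.trans[OF _ Inf_lower])
    then show ?thesis
      using \<open>r = Inf P\<close> by (simp add: Inf_superset_mono)
  qed
qed

end

theory Submission
  imports Defs
begin

text \<open>For compact \<open>c\<close>, the iterated squares \<open>c\<close>, \<open>c\<^sup>2\<close>, \<open>(c\<^sup>2)\<^sup>2\<close>, \<dots> form a decreasing sequence of
  compact elements with \<open>V(c\<^sup>2) = V(c)\<close>. An element maximal among those above \<open>x\<close> that bound no term
  of the sequence is prime, so \<open>V(x) \<subseteq> V(c)\<close> forces some term to lie below \<open>x\<close>; this term is
  compact, whence the complement of \<open>V(c)\<close> is compact. Conversely every compact open set is the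
  complement of some \<open>V(c)\<close> with \<open>c\<close> compact, and the condition on radicals makes these sets closed
  under intersection. Sobriety holds without any hypothesis: an irreducible closed set is the
  closure of its infimum.\<close>

section \<open>Compact elements, chains and maximal elements\<close>

lemma compact_element_bot: "compact_element bot"
  unfolding compact_element_def by (metis bot_least empty_subsetI finite.emptyI)

lemma compact_element_sup:
  assumes "compact_element c" "compact_element d"
  shows "compact_element (sup c d)"
  unfolding compact_element_def
proof (intro allI impI)
  fix S assume "sup c d \<le> Sup S"
  then obtain F G where "F \<subseteq> S" "finite F" "c \<le> Sup F" "G \<subseteq> S" "finite G" "d \<le> Sup G"
    using assms unfolding compact_element_def by (meson le_sup_iff)
  then show "\<exists>F\<subseteq>S. finite F \<and> sup c d \<le> Sup F"
    by (intro exI[of _ "F \<union> G"]) (auto simp: Sup_union_distrib intro: le_supI1 le_supI2)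
qed

lemma compact_element_Sup:
  assumes "finite F" "\<And>c. c \<in> F \<Longrightarrow> compact_element c"
  shows "compact_element (Sup F)"
  using assms by induction (auto intro: compact_element_bot compact_element_sup)

lemma finite_chain_bound:
  fixes C :: "'a::complete_lattice set"
  assumes "finite F" "F \<subseteq> C" "C \<noteq> {}"
    and chain: "\<And>a b. a \<in> C \<Longrightarrow> b \<in> C \<Longrightarrow> a \<le> b \<or> b \<le> a"
  shows "\<exists>u\<in>C. Sup F \<le> u"
  using assms(1,2)
proof induction
  case empty
  then show ?case using \<open>C \<noteq> {}\<close> by auto
next
  case (insert a F)
  then obtain u where "u \<in> C" "Sup F \<le> u" by auto
  then show ?case using insert.prems chain[of a u] by (auto intro: order_trans)
qed

text \<open>Compactness replaces \<open>Sup C\<close> by the join of a finite subset, and in a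
  nonempty chain such a join lies below a single member.\<close>

lemma compact_element_le_chain:
  fixes C :: "'a::complete_lattice set"
  assumes "compact_element c" "c \<le> Sup C" "C \<noteq> {}"
    and "\<And>a b. a \<in> C \<Longrightarrow> b \<in> C \<Longrightarrow> a \<le> b \<or> b \<le> a"
  shows "\<exists>u\<in>C. c \<le> u"
  using assms finite_chain_bound[of _ C] unfolding compact_element_def by (meson order_trans)

text \<open>Zorn's lemma: the join of a nonempty chain still avoids \<open>K\<close>, since a
  compact element below the join already lies below a member of the chain.\<close>

lemma exists_maximal_avoiding:
  fixes x :: "'a::complete_lattice"
  assumes compact: "\<And>c. c \<in> K \<Longrightarrow> compact_element c"
    and avoids: "\<And>c. c \<in> K \<Longrightarrow> \<not> c \<le> x"
  obtains p where "x \<le> p" "\<And>c. c \<in> K \<Longrightarrow> \<not> c \<le> p"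
    "\<And>y. p < y \<Longrightarrow> \<exists>c\<in>K. c \<le> y"
proof -
  define A where "A = {y. x \<le> y \<and> (\<forall>c\<in>K. \<not> c \<le> y)}"
  have "\<exists>m\<in>A. \<forall>a\<in>A. m \<le> a \<longrightarrow> a = m"
  proof (rule predicate_Zorn)
    show "partial_order_on A (relation_of (\<le>) A)"
      by (rule partial_order_on_relation_ofI) auto
    fix C assume C: "C \<in> Chains (relation_of (\<le>) A)"
    have CA: "C \<subseteq> A"
      and chain: "\<And>a b. a \<in> C \<Longrightarrow> b \<in> C \<Longrightarrow> a \<le> b \<or> b \<le> a"
      using C unfolding Chains_def relation_of_def by auto
    show "\<exists>u\<in>A. \<forall>a\<in>C. a \<le> u"
    proof (cases "C = {}")
      case True
      \<comment> \<open>The join of the empty chain is \<open>bot\<close>, which need not lie above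
        \<open>x\<close>; the bound here is \<open>x\<close> itself.\<close>
      then show ?thesis using avoids by (auto simp: A_def)
    next
      case False
      have "\<not> c \<le> Sup C" if c: "c \<in> K" for c
      proof
        assume "c \<le> Sup C"
        then obtain u where "u \<in> C" "c \<le> u"
          using compact_element_le_chain[OF compact[OF c] _ False] chain by blast
        then show False using CA c by (auto simp: A_def)
      qed
      moreover have "x \<le> Sup C"
        using False CA by (auto simp: A_def intro: Sup_upper2)
      ultimately show ?thesis
        by (auto simp: A_def intro!: bexI[of _ "Sup C"] Sup_upper)
    qed
  qed
  then obtain p where "p \<in> A" and max: "\<And>a. a \<in> A \<Longrightarrow> p \<le> a \<Longrightarrow> a = p" by blast
  have "\<exists>c\<in>K. c \<le> y" if "p < y" for y
    using max[of y] that \<open>p \<in> A\<close> by (fastforce simp: A_def)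
  then show thesis
    using that \<open>p \<in> A\<close> by (auto simp: A_def)
qed

section \<open>Iterated squares and compactness of basic open sets\<close>

lemma mult_mono_of_distrib:
  fixes a b c d :: "'a::complete_multiplicative_lattice"
  assumes "\<And>x y z::'a. x * sup y z = sup (x * y) (x * z)"
    and "\<And>x y z::'a. sup x y * z = sup (x * z) (y * z)"
    and "a \<le> b" "c \<le> d"
  shows "a * c \<le> b * d"
proof -
  have "a * c \<le> sup (a * c) (b * c)" by simp
  also have "\<dots> = b * c" using assms(2)[of a b c] \<open>a \<le> b\<close> by (simp add: sup_absorb2)
  also have "\<dots> \<le> sup (b * c) (b * d)" by simp
  also have "\<dots> = b * d" using assms(1)[of b c d] \<open>c \<le> d\<close> by (simp add: sup_absorb2)
  finally show ?thesis .
qed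

text \<open>If every iterated square avoids \<open>x\<close>, an element \<open>p\<close> above
  \<open>x\<close> maximal with this property is prime and not above \<open>c\<close>, so it lies in
  \<open>V_set x\<close> but not in \<open>V_set c\<close>.\<close>

lemma iterated_square_le_of_V_set_subset:
  fixes c x :: "'a::complete_multiplicative_lattice"
  assumes distrib_left: "\<And>x y z::'a. x * sup y z = sup (x * y) (x * z)"
    and distrib_right: "\<And>x y z::'a. sup x y * z = sup (x * z) (y * z)"
    and weak_Kaplansky: "\<And>x::'a. compact_element x \<Longrightarrow> compact_element (x * x)"
    and c: "compact_element c"
    and sub: "V_set x \<subseteq> V_set c"
  shows "\<exists>n. ((\<lambda>y. y * y) ^^ n) c \<le> x"
proof (rule ccontr)
  define s where "s n = ((\<lambda>y. y * y) ^^ n) c" for n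
  have s_0: "s 0 = c" and s_Suc: "\<And>n. s (Suc n) = s n * s n"
    by (simp_all add: s_def)
  have s_compact: "compact_element (s n)" for n
    by (induction n) (simp_all add: s_0 s_Suc c weak_Kaplansky)
  have le: "a * b \<le> a" "a * b \<le> b" for a b :: 'a
    using mult_le_inf[of a b] by auto
  have s_dec: "s n \<le> s m" if "m \<le> n" for m n
    by (rule lift_Suc_antimono_le[OF _ that]) (simp add: s_Suc le)
  assume "\<not> (\<exists>n. ((\<lambda>y. y * y) ^^ n) c \<le> x)"
  then have "\<And>n. \<not> s n \<le> x" by (simp add: s_def)
  then obtain p where p: "x \<le> p" "\<And>n. \<not> s n \<le> p" and max: "\<And>y. p < y \<Longrightarrow> \<exists>n. s n \<le> y"
    using s_compact by - (rule exists_maximal_avoiding[of "range s" x], blast+)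
  have "prime_element p"
    unfolding prime_element_def
  proof (intro conjI allI impI)
    show "p \<noteq> top" using p(2)[of 0] by auto
    fix a b assume ab: "a * b \<le> p"
    show "a \<le> p \<or> b \<le> p"
    proof (rule ccontr)
      assume "\<not> (a \<le> p \<or> b \<le> p)"
      then have "p < sup p a" "p < sup p b"
        by (simp_all add: less_le_not_le)
      then obtain m n where mn: "s m \<le> sup p a" "s n \<le> sup p b" using max by blast
      \<comment> \<open>The sequence decreases, so one index serves both joins, and squaring
        \<open>s k\<close> gives the next term.\<close>
      define k where "k = max m n"
      have "s k \<le> sup p a" "s k \<le> sup p b"
        using mn s_dec[of m k] s_dec[of n k] by (auto simp: k_def intro: order_trans)
      then have "s (Suc k) \<le> sup p a * sup p b"
        unfolding s_Suc by (rule mult_mono_of_distrib[OF distrib_left distrib_right])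
      \<comment> \<open>Distributivity expands the product into \<open>p * p\<close>,
        \<open>p * b\<close>, \<open>a * p\<close> and \<open>a * b\<close>: the first three lie
        below their factor \<open>p\<close>, the last by assumption.\<close>
      also have "\<dots> \<le> p"
        using ab by (simp add: distrib_left distrib_right le)
      finally show False using p(2) by blast
    qed
  qed
  then have "p \<in> V_set c" using sub p(1) by (auto simp: V_set_def Spec_def)
  then show False using p(2)[of 0] by (simp add: s_0 V_set_def)
qed

lemma V_set_iterated_square: "V_set (((\<lambda>y. y * y) ^^ n) c) = V_set c"
  by (induction n) (simp_all add: V_set_mult)

lemma V_set_antimono: "x \<le> y \<Longrightarrow> V_set y \<subseteq> V_set x"
  by (auto simp: V_set_def)

lemma compactin_zariski_compl_V_set:
  fixes c :: "'a::complete_multiplicative_lattice"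
  assumes "\<And>x y z::'a. x * sup y z = sup (x * y) (x * z)"
    and "\<And>x y z::'a. sup x y * z = sup (x * z) (y * z)"
    and "\<And>x::'a. compact_element x \<Longrightarrow> compact_element (x * x)"
    and c: "compact_element c"
  shows "compactin zariski_topology (Spec - V_set c)"
  unfolding compactin_def
proof (intro conjI allI impI)
  show "Spec - V_set c \<subseteq> topspace zariski_topology" by (simp add: topspace_zariski)
  fix \<U> :: "'a set set"
  assume \<U>: "Ball \<U> (openin zariski_topology) \<and> Spec - V_set c \<subseteq> \<Union>\<U>"
  then have cover: "Spec - V_set c \<subseteq> \<Union>\<U>" by blast
  have "\<forall>U\<in>\<U>. \<exists>x. U = Spec - V_set x" using \<U> by (simp add: openin_zariski)
  then obtain f where "\<forall>U\<in>\<U>. U = Spec - V_set (f U)" by (rule bchoice[THEN exE])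
  then have f: "p \<in> U \<longleftrightarrow> p \<in> Spec \<and> p \<notin> V_set (f U)" if "U \<in> \<U>" for p U
    using that by blast
  \<comment> \<open>Complementing the covering condition turns the union of open sets into the zero
    set of a join.\<close>
  have "V_set (Sup (f ` \<U>)) \<subseteq> V_set c"
    using cover f by (fastforce simp: V_set_Sup)
  with assms have "\<exists>n. ((\<lambda>y. y * y) ^^ n) c \<le> Sup (f ` \<U>)"
    by (rule iterated_square_le_of_V_set_subset)
  then obtain n where n: "((\<lambda>y. y * y) ^^ n) c \<le> Sup (f ` \<U>)" ..
  have "compact_element (((\<lambda>y. y * y) ^^ n) c)"
    by (induction n) (simp_all add: assms(3) c)
  then obtain G where G: "G \<subseteq> f ` \<U>" "finite G" "((\<lambda>y. y * y) ^^ n) c \<le> Sup G"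
    using n unfolding compact_element_def by blast
  obtain \<F> where \<F>: "\<F> \<subseteq> \<U>" "finite \<F>" "G = f ` \<F>"
    using finite_subset_image[OF G(2,1)] by blast
  \<comment> \<open>Finiteness was extracted for an iterated square of \<open>c\<close>, but this
    has the same zero set as \<open>c\<close>.\<close>
  from V_set_antimono[OF G(3)] have "V_set (Sup (f ` \<F>)) \<subseteq> V_set c"
    by (simp add: V_set_iterated_square \<F>(3))
  then have sub: "Spec \<inter> (\<Inter>U\<in>\<F>. V_set (f U)) \<subseteq> V_set c"
    by (simp add: V_set_Sup)
  have "Spec - V_set c \<subseteq> \<Union>\<F>"
  proof
    fix p assume p: "p \<in> Spec - V_set c"
    then obtain U where "U \<in> \<F>" "p \<notin> V_set (f U)" using sub by blast
    then show "p \<in> \<Union>\<F>" using p \<F>(1) f[of U p] by blast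
  qed
  then show "\<exists>\<F>. finite \<F> \<and> \<F> \<subseteq> \<U> \<and> Spec - V_set c \<subseteq> \<Union>\<F>"
    using \<F> by blast
qed

section \<open>Description of open and compact open sets\<close>

lemma open_zariski_eq_Union_compact:
  fixes U :: "'a::complete_multiplicative_lattice set"
  assumes algebraic: "\<And>x::'a. \<exists>S. (\<forall>s\<in>S. compact_element s) \<and> x = Sup S"
    and U: "openin zariski_topology U"
  obtains S where "\<forall>s\<in>S. compact_element s" "U = (\<Union>s\<in>S. Spec - V_set s)"
proof -
  obtain x where x: "U = Spec - V_set x" using U openin_zariski by blast
  obtain S where S: "\<forall>s\<in>S. compact_element s" "x = Sup S" using algebraic by blast
  have "U = (\<Union>s\<in>S. Spec - V_set s)"
    unfolding x S(2) V_set_Sup by blast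
  then show thesis using S that by blast
qed

text \<open>A finite subcover of the basic cover is indexed by finitely many compact elements, whose
  join is compact and serves as \<open>c\<close>.\<close>

lemma compact_open_zariski_eq_compl_V_set:
  fixes U :: "'a::complete_multiplicative_lattice set"
  assumes algebraic: "\<And>x::'a. \<exists>S. (\<forall>s\<in>S. compact_element s) \<and> x = Sup S"
    and U: "openin zariski_topology U" "compactin zariski_topology U"
  obtains c where "compact_element c" "U = Spec - V_set c"
proof -
  obtain S where S: "\<forall>s\<in>S. compact_element s" and U_eq: "U = (\<Union>s\<in>S. Spec - V_set s)"
    using algebraic U(1) by (rule open_zariski_eq_Union_compact)
  have "\<forall>V\<in>(\<lambda>s. Spec - V_set s) ` S. openin zariski_topology V"
    by (auto simp: openin_zariski)
  then obtain \<F> where \<F>: "finite \<F>" "\<F> \<subseteq> (\<lambda>s. Spec - V_set s) ` S" "U \<subseteq> \<Union>\<F>"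
    using U(2) U_eq unfolding compactin_def by (metis order_refl)
  then obtain F where F: "F \<subseteq> S" "finite F" "\<F> = (\<lambda>s. Spec - V_set s) ` F"
    by (meson finite_subset_image)
  have "U = Spec - V_set (Sup F)"
    using \<F>(3) F U_eq unfolding V_set_Sup by blast
  moreover have "compact_element (Sup F)"
    using F S by (blast intro: compact_element_Sup)
  ultimately show thesis using that by blast
qed

text \<open>Every prime above \<open>z\<close> is above \<open>radical z\<close>, which is the meet
  of these primes; so \<open>z\<close> and \<open>radical z\<close> have the same zero set.\<close>

lemma V_set_eq_of_radical_eq:
  fixes x y :: "'a::complete_multiplicative_lattice"
  assumes "radical x = radical y"
  shows "V_set x = V_set y"
proof -
  have "V_set z = V_set (radical z)" for z :: 'a
  proof
    show "V_set z \<subseteq> V_set (radical z)"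
      unfolding radical_eq_Inf by (auto simp: V_set_def intro: Inf_lower)
    have "z \<le> radical z"
      unfolding radical_eq_Inf by (rule Inf_greatest) (simp add: V_set_def)
    then show "V_set (radical z) \<subseteq> V_set z" by (rule V_set_antimono)
  qed
  then show ?thesis using assms by metis
qed

section \<open>Sobriety\<close>

lemma closure_of_zariski_singleton:
  assumes "p \<in> Spec"
  shows "zariski_topology closure_of {p} = V_set p"
proof (rule closure_of_unique)
  show "{p} \<subseteq> V_set p" using assms by (auto simp: V_set_def)
  show "closedin zariski_topology (V_set p)" by (auto simp: closedin_zariski)
  show "V_set p \<subseteq> T" if "{p} \<subseteq> T" "closedin zariski_topology T" for T
    using that unfolding closedin_zariski by (auto simp: V_set_def)
qed

lemma sober_space_zariski:
  "sober_space (zariski_topology :: 'a::complete_multiplicative_lattice topology)"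
  unfolding sober_space_def
proof (intro conjI allI impI)
  show "t0_space (zariski_topology :: 'a topology)"
    unfolding t0_space_def
  proof clarify
    fix p q :: 'a
    assume p: "p \<in> topspace zariski_topology" and q: "q \<in> topspace zariski_topology" and "p \<noteq> q"
    then have "\<not> p \<le> q \<or> \<not> q \<le> p" by auto
    moreover have "openin zariski_topology (Spec - V_set p)" "openin zariski_topology (Spec - V_set q)"
      by (auto simp: openin_zariski)
    ultimately show "\<exists>U. openin zariski_topology U \<and> (p \<notin> U) = (q \<in> U)"
      using p q unfolding topspace_zariski V_set_def by blast
  qed
next
  fix C :: "'a set"
  assume C: "closedin zariski_topology C \<and> irreducible_in zariski_topology C"
  then obtain x where x: "C = V_set x" unfolding closedin_zariski by blast
  have irr: "C \<noteq> {}" "\<And>a b. C \<subseteq> V_set a \<union> V_set b \<Longrightarrow> C \<subseteq> V_set a \<or> C \<subseteq> V_set b"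
    using C unfolding irreducible_in_def closedin_zariski by blast+
  \<comment> \<open>This turns irreducibility, a statement about closed sets containing
    \<open>C\<close>, into the primality of \<open>Inf C\<close>, because
    \<open>V_set (a * b)\<close> is the union of \<open>V_set a\<close> and
    \<open>V_set b\<close>.\<close>
  have sub_iff: "C \<subseteq> V_set a \<longleftrightarrow> a \<le> Inf C" for a
    unfolding x by (auto simp: V_set_def le_Inf_iff)
  obtain q where q: "q \<in> C" using irr(1) by blast
  have "prime_element (Inf C)"
    unfolding prime_element_def
  proof (intro conjI allI impI)
    have "q \<noteq> top" using q x by (auto simp: V_set_def Spec_def prime_element_def)
    then show "Inf C \<noteq> top" using q by (metis Inf_lower top_unique)
    show "a \<le> Inf C \<or> b \<le> Inf C" if "a * b \<le> Inf C" for a b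
      using irr(2) that unfolding sub_iff[symmetric] V_set_mult .
  qed
  then have "Inf C \<in> Spec" by (simp add: Spec_def)
  moreover have "C = V_set (Inf C)"
  proof
    show "C \<subseteq> V_set (Inf C)" by (simp add: sub_iff)
    have "x \<le> Inf C" using sub_iff[of x] x by blast
    then show "V_set (Inf C) \<subseteq> C" using V_set_antimono x by blast
  qed
  ultimately show "\<exists>p\<in>topspace zariski_topology. C = zariski_topology closure_of {p}"
    by (metis closure_of_zariski_singleton topspace_zariski)
qed

theorem theorem7p7:
  assumes compact: "compact_element (top :: 'a::complete_multiplicative_lattice)"
    and algebraic: "\<And>x::'a. \<exists>S. (\<forall>s\<in>S. compact_element s) \<and> x = Sup S"
    and distrib_left: "\<And>x y z::'a. x * sup y z = sup (x * y) (x * z)"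
    and distrib_right: "\<And>x y z::'a. sup x y * z = sup (x * z) (y * z)"
    and weak_Kaplansky: "\<And>x::'a. compact_element x \<Longrightarrow> compact_element (x * x)"
    and radical_compact: "\<And>x y::'a. compact_element x \<Longrightarrow> compact_element y \<Longrightarrow>
          \<exists>c. compact_element c \<and> radical c = radical (x * y)"
  shows "spectral_space (zariski_topology :: 'a topology)"
proof -
  let ?X = "zariski_topology :: 'a topology"
  have compactin: "compactin ?X (Spec - V_set c)" if "compact_element c" for c
    using distrib_left distrib_right weak_Kaplansky that
    by (rule compactin_zariski_compl_V_set)
  have openin: "openin ?X (Spec - V_set c)" for c
    by (auto simp: openin_zariski)
  show ?thesis
    unfolding spectral_space_def
  proof (intro conjI[OF _ conjI[OF sober_space_zariski conjI]] allI impI)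
    show "compact_space ?X"
      using compactin[OF compact] by (simp add: compact_space_def topspace_zariski V_set_top)
    show "\<exists>\<B>. (\<forall>B\<in>\<B>. openin ?X B \<and> compactin ?X B) \<and> U = \<Union>\<B>" if "openin ?X U" for U
    proof -
      obtain S where "\<forall>s\<in>S. compact_element s" "U = (\<Union>s\<in>S. Spec - V_set s)"
        using algebraic \<open>openin ?X U\<close> by (rule open_zariski_eq_Union_compact)
      then show ?thesis
        using compactin openin by (intro exI[of _ "(\<lambda>s. Spec - V_set s) ` S"]) auto
    qed
    fix \<F> assume "finite \<F> \<and> (\<forall>B\<in>\<F>. openin ?X B \<and> compactin ?X B)"
    then have \<F>: "finite \<F>" "\<forall>B\<in>\<F>. openin ?X B \<and> compactin ?X B" by auto
    show "openin ?X (topspace ?X \<inter> \<Inter>\<F>) \<and> compactin ?X (topspace ?X \<inter> \<Inter>\<F>)"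
    proof -
      have "\<exists>c. compact_element c \<and> topspace ?X \<inter> \<Inter>\<F> = Spec - V_set c"
        using \<F>
      proof induction
        case empty
        \<comment> \<open>The empty intersection is all of \<open>Spec\<close>, the complement of
          \<open>V_set top\<close>, so the compactness of \<open>top\<close> is what makes it
          compact.\<close>
        then show ?case using compact by (auto simp: topspace_zariski V_set_top)
      next
        case (insert B \<F>)
        then obtain c where c: "compact_element c" "topspace ?X \<inter> \<Inter>\<F> = Spec - V_set c" by auto
        have B: "openin ?X B" "compactin ?X B" using insert.prems by auto
        obtain d where d: "compact_element d" "B = Spec - V_set d"
          using algebraic B by (rule compact_open_zariski_eq_compl_V_set)
        \<comment> \<open>The intersection is the complement of \<open>V_set (d * c)\<close>, but
          \<open>d * c\<close> itself is not known to be compact; \<open>e\<close> is a compact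
          element with the same zero set.\<close>
        obtain e where e: "compact_element e" "radical e = radical (d * c)"
          using radical_compact c d by blast
        have "topspace ?X \<inter> \<Inter>(insert B \<F>) = B \<inter> (topspace ?X \<inter> \<Inter>\<F>)" by auto
        also have "\<dots> = Spec - V_set (d * c)" using c(2) d(2) by (auto simp: V_set_mult)
        also have "\<dots> = Spec - V_set e" using V_set_eq_of_radical_eq[OF e(2)] by simp
        finally show ?case using e(1) by blast
      qed
      then show ?thesis using compactin openin by metis
    qed
  qed
qed

end
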